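(* Let $R$ be a commutative ring with unity and let $M$ be an $R$-module with $\operatorname{Spec}(M)\neq\emptyset$. Then $\widetilde{\operatorname{Spec}(M)}$ is a $T_3$-space if and only if $\widetilde{D}(R-(P:M))$ is closed in $\widetilde{\operatorname{Spec}(M)}$ for all $P\in\widetilde{\operatorname{Spec}(M)}$.
   Context: For a submodule $N$ of an $R$-module $M$, $(N:M)=\{r\in R : rM\subseteq N\}$. A proper submodule $P$ of $M$ is prime if whenever $rm\in P$ with $r\in R$, $m\in M$, then $m\in P$ or $r\in(P:M)$; in this case $(P:M)$ is a prime ideal of $R$. $\operatorname{Spec}(M)$ is the set of all prime submodules of $M$. A subset $T\subseteq R$ is multiplicatively closed if $1\in T$ and $xy\in T$ whenever $x,y\in T$. For a family $\mathcal{S}=\{S_i\}_{i\in I}$ of multiplicatively closed subsets of $R$, $\widetilde{V}(\mathcal{S})=\{P\in\operatorname{Spec}(M) \mid (P:M)\cap S_i\neq\emptyset \text{ for all } i\in I\}$. $\widetilde{\operatorname{Spec}(M)}$ denotes the set $\operatorname{Spec}(M)$ with the topology whose closed sets are exactly the sets $\widetilde{V}(\mathcal{S})$, $\mathcal{S}$ ranging over all families of multiplicatively closed subsets of $R$. For a multiplicatively closed subset $T$ of $R$, $\widetilde{D}(T)=\{P\in\operatorname{Spec}(M) \mid (P:M)\cap T=\emptyset\}$, an open set; $R-(P:M)$ is the set complement of $(P:M)$ in $R$. A topological space $X$ is called a $T_3$-space here if for any closed set $C$ and any $x\in X-C$ there are disjoint open sets $U$ and $V$ with $C\subseteq U$ and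 $x\in V$ (no $T_0$ or $T_1$ condition is included). *)

theory Defs
  imports "HOL-Analysis.Abstract_Topological_Spaces" "HOL-Algebra.Module"
begin

text \<open>The residual \<open>(N : M)\<close>.\<close>

definition residual ::
    "('a, 'd) ring_scheme \<Rightarrow> ('a, 'b, 'c) module_scheme \<Rightarrow> 'b set \<Rightarrow> 'a set" where
  "residual R M N = {r \<in> carrier R. (\<lambda>m. r \<odot>\<^bsub>M\<^esub> m) ` carrier M \<subseteq> N}"

definition prime_submodule ::
    "('a, 'd) ring_scheme \<Rightarrow> ('a, 'b, 'c) module_scheme \<Rightarrow> 'b set \<Rightarrow> bool" where
  "prime_submodule R M P \<longleftrightarrow>
     Module.submodule P R M \<and> P \<noteq> carrier M \<and>
     (\<forall>r \<in> carrier R. \<forall>m \<in> carrier M. r \<odot>\<^bsub>M\<^esub> m \<in> P \<longrightarrow> m \<in> P \<or> r \<in> residual R M P)"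

definition module_spec ::
    "('a, 'd) ring_scheme \<Rightarrow> ('a, 'b, 'c) module_scheme \<Rightarrow> 'b set set" where
  "module_spec R M = {P. prime_submodule R M P}"

text \<open>
  For a ring \<open>R\<close>, \<open>submonoid T R\<close> refers to the multiplicative monoid of \<open>R\<close>: it says that \<open>T\<close> is
  a multiplicatively closed subset of \<open>R\<close>. The sets below depend only on the members of a family
  \<open>(S\<^sub>i)\<close>, not on its indexing, so families are rendered as sets of sets. The empty family is allowed.
\<close>

definition spec_V ::
    "('a, 'd) ring_scheme \<Rightarrow> ('a, 'b, 'c) module_scheme \<Rightarrow> 'a set set \<Rightarrow> 'b set set" where
  "spec_V R M \<S> = {P \<in> module_spec R M. \<forall>S \<in> \<S>. residual R M P \<inter> S \<noteq> {}}"

definition spec_D ::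
    "('a, 'd) ring_scheme \<Rightarrow> ('a, 'b, 'c) module_scheme \<Rightarrow> 'a set \<Rightarrow> 'b set set" where
  "spec_D R M T = {P \<in> module_spec R M. residual R M P \<inter> T = {}}"

definition spec_topology ::
    "('a, 'd) ring_scheme \<Rightarrow> ('a, 'b, 'c) module_scheme \<Rightarrow> 'b set topology" where
  "spec_topology R M =
     topology (\<lambda>U. \<exists>\<S>. (\<forall>S \<in> \<S>. submonoid S R) \<and> U = module_spec R M - spec_V R M \<S>)"

text \<open>
  The complements of the sets \<open>spec_V R M \<S>\<close> do form a topology, so \<open>spec_topology\<close> has the
  intended open and closed sets.
\<close>

lemma residual_prime:
  assumes "Module.module R M" "P \<in> module_spec R M"
    and "a \<in> carrier R" "b \<in> carrier R" "a \<otimes>\<^bsub>R\<^esub> b \<in> residual R M P"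
  shows "a \<in> residual R M P \<or> b \<in> residual R M P"
proof (rule disjCI)
  interpret Module.module R M by fact
  assume "b \<notin> residual R M P"
  then obtain m where m: "m \<in> carrier M" "b \<odot>\<^bsub>M\<^esub> m \<notin> P"
    using assms(4) by (auto simp: residual_def)
  have "a \<odot>\<^bsub>M\<^esub> (b \<odot>\<^bsub>M\<^esub> m) \<in> P"
    using assms m by (auto simp: residual_def smult_assoc1[symmetric])
  then show "a \<in> residual R M P"
    using assms(2,3,4) m smult_closed[OF assms(4) m(1)]
    by (auto simp: module_spec_def prime_submodule_def)
qed

lemma residual_mult:
  assumes "Module.module R M" "P \<in> module_spec R M"
    and "a \<in> carrier R" "b \<in> carrier R" "a \<in> residual R M P \<or> b \<in> residual R M P"
  shows "a \<otimes>\<^bsub>R\<^esub> b \<in> residual R M P"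
proof -
  interpret Module.module R M by fact
  have P: "Module.submodule P R M"
    using assms(2) by (simp add: module_spec_def prime_submodule_def)
  have "(a \<otimes>\<^bsub>R\<^esub> b) \<odot>\<^bsub>M\<^esub> m \<in> P" if m: "m \<in> carrier M" for m
  proof -
    have "a \<odot>\<^bsub>M\<^esub> (b \<odot>\<^bsub>M\<^esub> m) \<in> P"
      using assms(5)
    proof
      assume "a \<in> residual R M P"
      then show ?thesis using m assms(4) by (auto simp: residual_def)
    next
      assume "b \<in> residual R M P"
      then have "b \<odot>\<^bsub>M\<^esub> m \<in> P" using m by (auto simp: residual_def)
      then show ?thesis using submodule.smult_closed[OF P] assms(3) by blast
    qed
    then show ?thesis using m assms by (simp add: smult_assoc1)
  qed
  then show ?thesis using assms by (auto simp: residual_def)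
qed

lemma one_notin_residual:
  assumes "Module.module R M" "P \<in> module_spec R M"
  shows "\<one>\<^bsub>R\<^esub> \<notin> residual R M P"
proof
  interpret Module.module R M by fact
  assume "\<one>\<^bsub>R\<^esub> \<in> residual R M P"
  then have "carrier M \<subseteq> P" by (force simp: residual_def)
  moreover have "Module.submodule P R M" "P \<noteq> carrier M"
    using assms(2) by (simp_all add: module_spec_def prime_submodule_def)
  ultimately show False
    using submoduleE(1) by blast
qed

lemma submonoid_mult_set:
  fixes R (structure)
  assumes "cring R" "submonoid S R" "submonoid T R"
  shows "submonoid {s \<otimes> t |s t. s \<in> S \<and> t \<in> T} R"
proof -
  interpret cring R by fact
  interpret S: submonoid S R by fact
  interpret T: submonoid T R by fact
  show ?thesis
  proof
    show "{s \<otimes> t |s t. s \<in> S \<and> t \<in> T} \<subseteq> carrier R" by auto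
    show "\<one> \<in> {s \<otimes> t |s t. s \<in> S \<and> t \<in> T}"
      unfolding mem_Collect_eq using S.one_closed T.one_closed r_one[OF one_closed, symmetric]
      by (intro exI[of _ \<one>] conjI)
    fix x y
    assume "x \<in> {s \<otimes> t |s t. s \<in> S \<and> t \<in> T}" "y \<in> {s \<otimes> t |s t. s \<in> S \<and> t \<in> T}"
    then obtain s t s' t' where st: "x = s \<otimes> t" "y = s' \<otimes> t'" "s \<in> S" "t \<in> T" "s' \<in> S" "t' \<in> T"
      by blast
    then have "x \<otimes> y = (s \<otimes> s') \<otimes> (t \<otimes> t')" by (simp add: m_ac)
    then show "x \<otimes> y \<in> {s \<otimes> t |s t. s \<in> S \<and> t \<in> T}"
      using st S.m_closed T.m_closed by blast
  qed
qed

lemma spec_V_Un: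
  assumes M: "Module.module R M"
    and S: "\<And>S. S \<in> \<S> \<Longrightarrow> submonoid S R" and T: "\<And>T. T \<in> \<T> \<Longrightarrow> submonoid T R"
  shows "spec_V R M \<S> \<union> spec_V R M \<T> =
    spec_V R M {{s \<otimes>\<^bsub>R\<^esub> t |s t. s \<in> S \<and> t \<in> T} |S T. S \<in> \<S> \<and> T \<in> \<T>}" (is "?L = spec_V R M ?U")
proof -
  have meets: "residual R M P \<inter> {s \<otimes>\<^bsub>R\<^esub> t |s t. s \<in> S \<and> t \<in> T} \<noteq> {} \<longleftrightarrow>
      residual R M P \<inter> S \<noteq> {} \<or> residual R M P \<inter> T \<noteq> {}"
    if P: "P \<in> module_spec R M" and "S \<in> \<S>" "T \<in> \<T>" for P S T
  proof -
    interpret S: submonoid S R using S that by blast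
    interpret T: submonoid T R using T that by blast
    show ?thesis
    proof
      assume "residual R M P \<inter> {s \<otimes>\<^bsub>R\<^esub> t |s t. s \<in> S \<and> t \<in> T} \<noteq> {}"
      then obtain s t where "s \<in> S" "t \<in> T" "s \<otimes>\<^bsub>R\<^esub> t \<in> residual R M P" by blast
      then show "residual R M P \<inter> S \<noteq> {} \<or> residual R M P \<inter> T \<noteq> {}"
        using residual_prime[OF M P, of s t] by auto
    next
      assume "residual R M P \<inter> S \<noteq> {} \<or> residual R M P \<inter> T \<noteq> {}"
      then obtain s t where "s \<in> S" "t \<in> T" "s \<in> residual R M P \<or> t \<in> residual R M P"
        using S.one_closed T.one_closed by blast
      then show "residual R M P \<inter> {s \<otimes>\<^bsub>R\<^esub> t |s t. s \<in> S \<and> t \<in> T} \<noteq> {}"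
        using residual_mult[OF M P, of s t] by auto
    qed
  qed
  show ?thesis
  proof (rule Set.set_eqI)
    fix P
    show "P \<in> ?L \<longleftrightarrow> P \<in> spec_V R M ?U"
    proof (cases "P \<in> module_spec R M")
      case True
      have "P \<in> spec_V R M ?U \<longleftrightarrow> (\<forall>S\<in>\<S>. \<forall>T\<in>\<T>.
          residual R M P \<inter> {s \<otimes>\<^bsub>R\<^esub> t |s t. s \<in> S \<and> t \<in> T} \<noteq> {})"
        using True unfolding spec_V_def by blast
      also have "\<dots> \<longleftrightarrow> (\<forall>S\<in>\<S>. \<forall>T\<in>\<T>. residual R M P \<inter> S \<noteq> {} \<or> residual R M P \<inter> T \<noteq> {})"
        using meets[OF True] by (intro ball_cong refl) blast
      also have "\<dots> \<longleftrightarrow> P \<in> ?L"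
        using True unfolding spec_V_def by blast
      finally show ?thesis by blast
    qed (simp add: spec_V_def)
  qed
qed

lemma openin_spec_topology:
  assumes M: "Module.module R M"
  shows "openin (spec_topology R M) U \<longleftrightarrow>
    (\<exists>\<S>. (\<forall>S \<in> \<S>. submonoid S R) \<and> U = module_spec R M - spec_V R M \<S>)"
proof -
  have "istopology (\<lambda>U. \<exists>\<S>. (\<forall>S \<in> \<S>. submonoid S R) \<and> U = module_spec R M - spec_V R M \<S>)"
    unfolding istopology_def
  proof safe
    fix U V \<S> \<T>
    assume S: "\<forall>S \<in> \<S>. submonoid S R" and T: "\<forall>T \<in> \<T>. submonoid T R"
    let ?U = "{{s \<otimes>\<^bsub>R\<^esub> t |s t. s \<in> S \<and> t \<in> T} |S T. S \<in> \<S> \<and> T \<in> \<T>}"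
    have "cring R" using M by (simp add: Module.module_def)
    then have "\<forall>S \<in> ?U. submonoid S R" using S T submonoid_mult_set by blast
    moreover have "spec_V R M \<S> \<union> spec_V R M \<T> = spec_V R M ?U"
      using S T by (intro spec_V_Un[OF M]) auto
    then have "(module_spec R M - spec_V R M \<S>) \<inter> (module_spec R M - spec_V R M \<T>) =
        module_spec R M - spec_V R M ?U" by blast
    ultimately show "\<exists>\<U>. (\<forall>S \<in> \<U>. submonoid S R) \<and>
        (module_spec R M - spec_V R M \<S>) \<inter> (module_spec R M - spec_V R M \<T>) =
        module_spec R M - spec_V R M \<U>" by blast
  next
    fix \<K>
    assume "\<forall>U\<in>\<K>. \<exists>\<S>. (\<forall>S \<in> \<S>. submonoid S R) \<and> U = module_spec R M - spec_V R M \<S>"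
    then obtain f where f: "\<And>U. U \<in> \<K> \<Longrightarrow> \<forall>S \<in> f U. submonoid S R"
        "\<And>U. U \<in> \<K> \<Longrightarrow> U = module_spec R M - spec_V R M (f U)"
      by metis
    have "\<Union>\<K> = (\<Union>U\<in>\<K>. module_spec R M - spec_V R M (f U))"
      using f(2) by auto
    also have "\<dots> = module_spec R M - spec_V R M (\<Union>(f ` \<K>))"
      unfolding spec_V_def by blast
    finally show "\<exists>\<S>. (\<forall>S \<in> \<S>. submonoid S R) \<and> \<Union>\<K> = module_spec R M - spec_V R M \<S>"
      using f(1) by (intro exI[of _ "\<Union>(f ` \<K>)"] conjI ballI) auto
  qed
  then show ?thesis by (simp add: spec_topology_def)
qed

lemma topspace_spec_topology:
  assumes M: "Module.module R M"
  shows "topspace (spec_topology R M) = module_spec R M"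
proof -
  interpret Module.module R M by fact
  have "spec_V R M {{\<one>\<^bsub>R\<^esub>}} = {}"
    using one_notin_residual[OF M] by (auto simp: spec_V_def)
  moreover have "submonoid {\<one>\<^bsub>R\<^esub>} R" by unfold_locales auto
  ultimately have "openin (spec_topology R M) (module_spec R M)"
    unfolding openin_spec_topology[OF M] by (intro exI[of _ "{{\<one>\<^bsub>R\<^esub>}}"]) auto
  then have "module_spec R M \<subseteq> topspace (spec_topology R M)"
    by (rule openin_subset)
  moreover have "topspace (spec_topology R M) \<subseteq> module_spec R M"
    using openin_topspace[of "spec_topology R M"] unfolding openin_spec_topology[OF M] by auto
  ultimately show ?thesis by (rule subset_antisym[rotated])
qed

lemma closedin_spec_topology:
  assumes M: "Module.module R M"
  shows "closedin (spec_topology R M) C \<longleftrightarrow> (\<exists>\<S>. (\<forall>S \<in> \<S>. submonoid S R) \<and> C = spec_V R M \<S>)"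
proof -
  have "spec_V R M \<S> \<subseteq> module_spec R M" for \<S> by (auto simp: spec_V_def)
  then show ?thesis
    unfolding closedin_def topspace_spec_topology[OF M] openin_spec_topology[OF M]
    by (metis double_diff order_refl)
qed

end

theory Submission
  imports Defs
begin

text \<open>
  \<open>spec_D R M (carrier R - residual R M P)\<close> is the least open neighbourhood of \<open>P\<close>: a basic open
  set \<open>spec_D R M S\<close> contains, with \<open>P\<close>, every prime submodule \<open>Q\<close> with \<open>(Q : M) \<subseteq> (P : M)\<close>.
  In any space where every point has a least open neighbourhood, regularity means that
  these neighbourhoods are closed.
\<close>

lemma regular_space_iff_least_nbhds_closed:
  assumes least: "\<And>x. x \<in> topspace X \<Longrightarrow> openin X (N x) \<and> x \<in> N x"
    "\<And>x U. openin X U \<Longrightarrow> x \<in> U \<Longrightarrow> N x \<subseteq> U"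
  shows "regular_space X \<longleftrightarrow> (\<forall>x \<in> topspace X. closedin X (N x))"
proof
  assume reg: "regular_space X"
  show "\<forall>x \<in> topspace X. closedin X (N x)"
  proof
    fix x assume x: "x \<in> topspace X"
    have N: "openin X (N x)" "x \<in> N x"
      using least(1)[OF x] by auto
    \<comment> \<open>Regularity is applied to \<open>x\<close> and the complement of its least
      neighbourhood.\<close>
    have "closedin X (topspace X - N x)" "x \<in> topspace X - (topspace X - N x)"
      using N x by auto
    then obtain U V where UV: "openin X U" "openin X V" "x \<in> U" "topspace X - N x \<subseteq> V" "disjnt U V"
      using reg unfolding regular_space_def by meson
    have "N x \<subseteq> U" using least(2) UV by blast
    \<comment> \<open>\<open>V\<close> misses \<open>U\<close>, hence \<open>N x\<close>, yet covers
      the complement of \<open>N x\<close>; so that complement is the open set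
      \<open>V\<close>.\<close>
    then have "V = topspace X - N x"
      using UV openin_subset[OF UV(2)] by (auto simp: disjnt_iff)
    then show "closedin X (N x)"
      using UV(2) openin_subset[OF N(1)] by (simp add: closedin_def)
  qed
next
  assume closed: "\<forall>x \<in> topspace X. closedin X (N x)"
  show "regular_space X"
    unfolding regular_space_def
  proof (intro allI impI, elim conjE)
    fix C x assume C: "closedin X C" and x: "x \<in> topspace X - C"
    have "openin X (topspace X - C)" using C by blast
    then have "N x \<subseteq> topspace X - C" using least(2) x by blast
    \<comment> \<open>Since \<open>N x\<close> is clopen, it and its complement separate
      \<open>x\<close> from \<open>C\<close>.\<close>
    then show "\<exists>U V. openin X U \<and> openin X V \<and> x \<in> U \<and> C \<subseteq> V \<and> disjnt U V"
      using least(1)[of x] closed x closedin_subset[OF C]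
      by (intro exI[of _ "N x"] exI[of _ "topspace X - N x"]) (auto simp: disjnt_iff)
  qed
qed

lemma submonoid_Diff_residual:
  assumes M: "Module.module R M" and P: "P \<in> module_spec R M"
  shows "submonoid (carrier R - residual R M P) R"
proof -
  interpret Module.module R M by fact
  show ?thesis
    using one_notin_residual[OF M P] residual_prime[OF M P] by unfold_locales auto
qed

lemma openin_spec_D:
  assumes M: "Module.module R M" and S: "submonoid S R"
  shows "openin (spec_topology R M) (spec_D R M S)"
  unfolding openin_spec_topology[OF M]
  using S by (intro exI[of _ "{S}"]) (auto simp: spec_D_def spec_V_def)

text \<open>Residuals lie in \<open>carrier R\<close>, so missing the complement of one means
  inclusion in it. Membership of \<open>P\<close> becomes reflexivity.\<close>

lemma spec_D_Diff_residual:
  "spec_D R M (carrier R - residual R M P) =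
    {Q \<in> module_spec R M. residual R M Q \<subseteq> residual R M P}"
  by (auto simp: spec_D_def residual_def)

text \<open>As \<open>P\<close> lies in \<open>U\<close>, some member of the family defining
  \<open>U\<close> misses \<open>residual R M P\<close>; it then misses every smaller
  residual.\<close>

lemma spec_D_Diff_residual_least:
  assumes M: "Module.module R M" and U: "openin (spec_topology R M) U" "P \<in> U"
  shows "spec_D R M (carrier R - residual R M P) \<subseteq> U"
  using U unfolding openin_spec_topology[OF M] spec_D_Diff_residual spec_V_def by blast

theorem theorem11:
  fixes R :: "('a, 'd) ring_scheme" and M :: "('a, 'b, 'c) module_scheme"
  assumes "Module.module R M"
    and "module_spec R M \<noteq> {}"
  shows "regular_space (spec_topology R M) \<longleftrightarrow>
    (\<forall>P \<in> module_spec R M.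
       closedin (spec_topology R M) (spec_D R M (carrier R - residual R M P)))"
proof -
  note M = assms(1)
  have "openin (spec_topology R M) (spec_D R M (carrier R - residual R M P)) \<and>
      P \<in> spec_D R M (carrier R - residual R M P)"
    if "P \<in> module_spec R M" for P
    using openin_spec_D[OF M submonoid_Diff_residual[OF M that]] that
    by (simp add: spec_D_Diff_residual)
  then show ?thesis
    using regular_space_iff_least_nbhds_closed
      [of "spec_topology R M" "\<lambda>P. spec_D R M (carrier R - residual R M P)"]
      spec_D_Diff_residual_least[OF M]
    by (simp add: topspace_spec_topology[OF M])
qed

end
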